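(* Let $M$ and $K$ be unit-speed curves in $\mathbb{R}^3$ given by $\gamma:I\to\mathbb{R}^3$ and $\beta:I\to\mathbb{R}^3$, respectively, and let $\kappa>0$ and $\tau$ be the curvature and torsion of $M$. Suppose that $$\beta''(s)=S_T(s)\,\gamma'(s),\qquad S_T(s)=\kappa(s)\cos\left(\int_0^s\tau(u)\,du+\theta_0\right),$$ for all $s\in I$, where $\theta_0$ is a real constant. Then the following are equivalent: 1) $M$ is a spherical curve; 2) $K$ is a Bertrand curve or a $B$-Bertrand curve.
   Context: All curves are smooth, $I$ is an open interval containing $0$, and $M$ and $K$ share the arc-length parameter $s$. $M$ has a Frenet frame ($\kappa>0$), and $S_T$ is nowhere zero so that $K$ also has a Frenet frame. A curve is spherical if it lies on some sphere of $\mathbb{R}^3$ (of some radius and center). Let $\overline\kappa,\overline\tau$ be the curvature and torsion of $K$. The curvature is allowed to be signed: the Frenet apparatus $\{\overline T,\overline N,\overline B,\overline\kappa,\overline\tau\}$ of $K$ is a positively oriented orthonormal frame with $\overline T=\beta'$, $\overline T'=\overline\kappa\,\overline N$, $\overline N'=-\overline\kappa\,\overline T+\overline\tau\,\overline B$, $\overline B'=-\overline\tau\,\overline N$; the sign of $\overline\kappa$ is immaterial below. A curve with curvature $\overline\kappa$ and torsion $\overline\tau$ is a Bertrand curve if there are constants $\lambda\neq0$ and $\mu$ in $\mathbb{R}$ with $\lambda\overline\kappa+\mu\overline\tau=1$ (writing $\mu=\lambda\cot\theta$), and it is a $B$-Bertrand curve if there are constants $\lambda$ and $\mu\neq0$ in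 $\mathbb{R}$ with $\lambda\overline\kappa+\mu\overline\tau=-1$ (writing $\lambda=\mu\tan\theta$). Thus $K$ is a Bertrand or a $B$-Bertrand curve if and only if there are constants $\lambda,\mu\in\mathbb{R}$ with $\lambda\overline\kappa+\mu\overline\tau=1$ on $I$. *)

theory Defs
  imports "HOL-Analysis.Analysis"
begin

text \<open>
  A curve is a function on all of \<open>real\<close> of which only the values on an open interval \<open>I\<close>
  matter: every derivative below is a two-sided derivative at a point of \<open>I\<close>.
\<close>

definition nth_vderiv :: "nat \<Rightarrow> (real \<Rightarrow> 'a::real_normed_vector) \<Rightarrow> real \<Rightarrow> 'a" where
  "nth_vderiv n f = ((\<lambda>g s. vector_derivative g (at s)) ^^ n) f"

definition smooth_curve :: "real set \<Rightarrow> (real \<Rightarrow> 'a::real_normed_vector) \<Rightarrow> bool" where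
  "smooth_curve I f \<longleftrightarrow> (\<forall>n. \<forall>s\<in>I. nth_vderiv n f differentiable (at s))"

definition unit_speed_curve :: "real set \<Rightarrow> (real \<Rightarrow> real ^ 3) \<Rightarrow> bool" where
  "unit_speed_curve I c \<longleftrightarrow> smooth_curve I c \<and> (\<forall>s\<in>I. norm (nth_vderiv 1 c s) = 1)"

text \<open>
  The curvature \<open>k\<close> may be negative. Where it has no zeros, the frame is determined up to
  replacing \<open>(N, B, k)\<close> by \<open>(- N, - B, - k)\<close>, which leaves the torsion \<open>t\<close> unchanged.
\<close>

definition frenet_apparatus ::
  "real set \<Rightarrow> (real \<Rightarrow> real ^ 3) \<Rightarrow> (real \<Rightarrow> real ^ 3) \<Rightarrow> (real \<Rightarrow> real ^ 3) \<Rightarrow> (real \<Rightarrow> real ^ 3) \<Rightarrow>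
   (real \<Rightarrow> real) \<Rightarrow> (real \<Rightarrow> real) \<Rightarrow> bool" where
  "frenet_apparatus I c T N B k t \<longleftrightarrow>
    (\<forall>s\<in>I.
      norm (T s) = 1 \<and> norm (N s) = 1 \<and> norm (B s) = 1 \<and>
      T s \<bullet> N s = 0 \<and> T s \<bullet> B s = 0 \<and> N s \<bullet> B s = 0 \<and>
      det (vector [T s, N s, B s] :: real ^ 3 ^ 3) > 0 \<and>
      (c has_vector_derivative T s) (at s) \<and>
      (T has_vector_derivative k s *\<^sub>R N s) (at s) \<and>
      (N has_vector_derivative - k s *\<^sub>R T s + t s *\<^sub>R B s) (at s) \<and>
      (B has_vector_derivative - t s *\<^sub>R N s) (at s))"

definition has_curvature_torsion ::
  "real set \<Rightarrow> (real \<Rightarrow> real ^ 3) \<Rightarrow> (real \<Rightarrow> real) \<Rightarrow> (real \<Rightarrow> real) \<Rightarrow> bool" where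
  "has_curvature_torsion I c k t \<longleftrightarrow> (\<exists>T N B. frenet_apparatus I c T N B k t)"

definition spherical_curve :: "real set \<Rightarrow> (real \<Rightarrow> real ^ 3) \<Rightarrow> bool" where
  "spherical_curve I c \<longleftrightarrow> (\<exists>p r. r > 0 \<and> (\<forall>s\<in>I. c s \<in> sphere p r))"

text \<open>
  In the next two definitions the choice of the sign of \<open>k\<close> is immaterial, since \<open>l\<close> can be
  replaced by \<open>- l\<close>.
\<close>

definition bertrand_curve :: "real set \<Rightarrow> (real \<Rightarrow> real ^ 3) \<Rightarrow> bool" where
  "bertrand_curve I c \<longleftrightarrow>
    (\<exists>k t. has_curvature_torsion I c k t \<and>
      (\<exists>l m. l \<noteq> 0 \<and> (\<forall>s\<in>I. l * k s + m * t s = 1)))"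

definition B_bertrand_curve :: "real set \<Rightarrow> (real \<Rightarrow> real ^ 3) \<Rightarrow> bool" where
  "B_bertrand_curve I c \<longleftrightarrow>
    (\<exists>k t. has_curvature_torsion I c k t \<and>
      (\<exists>l m. m \<noteq> 0 \<and> (\<forall>s\<in>I. l * k s + m * t s = - 1)))"

end

theory Submission
  imports Defs
begin

text \<open>
  Let \<open>(T, N, B)\<close> be the frame of \<open>\<gamma>\<close> and \<open>U = \<beta>'\<close>. Since \<open>U\<close> is a unit field with
  \<open>U' = S_T T\<close>, it is orthogonal to \<open>T\<close>, and \<open>(U, T, U \<times> T)\<close> is a Frenet frame of \<open>\<beta>\<close>. The
  components \<open>y = U \<bullet> N\<close> and \<open>x = U \<bullet> B\<close> satisfy \<open>y' = \<tau> x\<close>, \<open>x' = - \<tau> y\<close> and \<open>x\<^sup>2 + y\<^sup>2 = 1\<close>, and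
  \<open>\<beta>\<close> has curvature \<open>S_T = - \<kappa> y\<close> and torsion \<open>\<kappa> x\<close>. So (B-)Bertrand means that \<open>1 / \<kappa>\<close> is a
  constant combination of \<open>x\<close> and \<open>y\<close>. On the other hand \<open>\<gamma>\<close> lies on a sphere iff \<open>\<rho> = 1 / \<kappa>\<close>
  has a companion \<open>q\<close> with \<open>\<rho>' = \<tau> q\<close> and \<open>q' = - \<tau> \<rho>\<close>, the centre being \<open>\<gamma> + \<rho> N + q B\<close>.
  Both conditions agree because the solutions of this rotation system are exactly the
  constant combinations of \<open>(y, x)\<close> and \<open>(x, - y)\<close>.
\<close>

unbundle cross3_syntax

section \<open>Calculus on an interval and orthonormal frames in space\<close>

lemmas has_vector_derivative_inner =
  bounded_bilinear.has_vector_derivative[OF bounded_bilinear_inner]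

lemma constant_on_interval:
  fixes f :: "real \<Rightarrow> 'a::real_normed_vector"
  assumes "is_interval I" and "\<And>s. s \<in> I \<Longrightarrow> (f has_vector_derivative 0) (at s)"
  obtains c where "\<And>s. s \<in> I \<Longrightarrow> f s = c"
  using has_vector_derivative_zero_constant[OF is_interval_convex[OF assms(1)]]
    has_vector_derivative_at_within[OF assms(2)] by metis

text \<open>The unit vector \<open>a \<times> b\<close> is parallel to \<open>c\<close>, because the
  Lagrange identity makes \<open>(a \<times> b) \<times> c\<close> vanish. So their inner product is
  1 or -1, and the determinant decides the sign.\<close>

lemma positive_orthonormal_cross:
  fixes a b c :: "real^3"
  assumes "norm a = 1" "norm b = 1" "norm c = 1"
    and "a \<bullet> b = 0" "a \<bullet> c = 0" "b \<bullet> c = 0"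
    and "det (vector [a, b, c] :: real^3^3) > 0"
  shows "a \<times> b = c"
proof -
  define d where "d = (a \<times> b) \<bullet> c"
  have "d > 0"
    using assms(7) dot_cross_det[of a b c] cross_triple[of a b c]
    by (simp add: d_def inner_commute)
  have "(norm (a \<times> b))\<^sup>2 = 1"
    by (simp add: norm_cross assms)
  moreover have "(a \<times> b) \<times> c = 0"
    using cross_skew[of "a \<times> b" c] Lagrange[of c a b] assms by (simp add: inner_commute)
  ultimately have "d\<^sup>2 = 1"
    using norm_cross_dot[of "a \<times> b" c] assms(3) by (simp add: d_def power_mult_distrib)
  with \<open>d > 0\<close> have "d = 1"
    by (simp add: power2_eq_1_iff)
  \<comment> \<open>Two unit vectors with inner product 1 coincide.\<close>
  have "(norm (a \<times> b - c))\<^sup>2 = (norm (a \<times> b))\<^sup>2 + (norm c)\<^sup>2 - 2 * d"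
    unfolding power2_norm_eq_inner d_def by (simp add: inner_diff inner_commute)
  then show ?thesis
    using \<open>(norm (a \<times> b))\<^sup>2 = 1\<close> \<open>d = 1\<close> assms(3) by simp
qed

text \<open>The remainder \<open>w\<close> of the expansion is orthogonal to \<open>a\<close> and
  \<open>b\<close>, hence parallel to the unit vector \<open>a \<times> b\<close>; being orthogonal
  to that too, it is zero.\<close>

lemma cross_frame_expansion:
  fixes a b v :: "real^3"
  assumes "norm a = 1" "norm b = 1" "a \<bullet> b = 0"
  shows "v = (v \<bullet> a) *\<^sub>R a + (v \<bullet> b) *\<^sub>R b + (v \<bullet> (a \<times> b)) *\<^sub>R (a \<times> b)"
proof -
  let ?c = "a \<times> b"
  have c: "?c \<bullet> ?c = 1"
    using norm_cross[of a b] assms by (simp add: power2_norm_eq_inner[symmetric])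
  have ab: "a \<bullet> a = 1" "b \<bullet> b = 1" "b \<bullet> a = 0"
    using assms by (simp_all add: norm_eq_1 inner_commute)
  define w where "w = v - ((v \<bullet> a) *\<^sub>R a + (v \<bullet> b) *\<^sub>R b + (v \<bullet> ?c) *\<^sub>R ?c)"
  have "w \<bullet> a = 0" "w \<bullet> b = 0" "w \<bullet> ?c = 0"
    by (simp_all add: w_def inner_diff_left inner_add_left assms ab c dot_cross_self)
  then have "w = 0"
    using norm_and_cross_eq_0[of w ?c] Lagrange[of w a b] c by auto
  then show ?thesis
    by (simp add: w_def)
qed

section \<open>Frenet frames: coordinates and uniqueness of curvature and torsion\<close>

lemma frenet_apparatusD:
  assumes "frenet_apparatus I c T N B k t" and "s \<in> I"
  shows "norm (T s) = 1" "norm (N s) = 1" "norm (B s) = 1"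
    and "T s \<bullet> N s = 0" "T s \<bullet> B s = 0" "N s \<bullet> B s = 0"
    and "T s \<times> N s = B s"
    and "(c has_vector_derivative T s) (at s)"
    and "(T has_vector_derivative k s *\<^sub>R N s) (at s)"
    and "(N has_vector_derivative - k s *\<^sub>R T s + t s *\<^sub>R B s) (at s)"
    and "(B has_vector_derivative - t s *\<^sub>R N s) (at s)"
  using assms unfolding frenet_apparatus_def
  by (auto intro!: positive_orthonormal_cross)

lemma frenet_expansion:
  assumes "frenet_apparatus I c T N B k t" and "s \<in> I"
  shows "v = (v \<bullet> T s) *\<^sub>R T s + (v \<bullet> N s) *\<^sub>R N s + (v \<bullet> B s) *\<^sub>R B s"
  using cross_frame_expansion[of "T s" "N s" v] frenet_apparatusD[OF assms] by simp

lemma frenet_inner: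
  assumes "frenet_apparatus I c T N B k t" and "s \<in> I"
  shows "v \<bullet> w = (v \<bullet> T s) * (w \<bullet> T s) + (v \<bullet> N s) * (w \<bullet> N s) + (v \<bullet> B s) * (w \<bullet> B s)"
  using arg_cong[OF frenet_expansion[OF assms, of v], of "\<lambda>u. u \<bullet> w"]
  by (simp add: inner_add_left inner_commute[of w])

text \<open>The curve fixes the tangent, so the products of curvature and normal agree and the
  normals differ by a sign. This sign is constant on the interval; it enters the curvature once and
  the torsion twice.\<close>

lemma frenet_curvature_torsion_unique:
  assumes "open I" "is_interval I"
    and F: "frenet_apparatus I c T N B k t" and G: "frenet_apparatus I c T' N' B' k' t'"
    and k: "\<And>s. s \<in> I \<Longrightarrow> k s \<noteq> 0"
  obtains e :: real where "\<And>s. s \<in> I \<Longrightarrow> k' s = e * k s" and "\<And>s. s \<in> I \<Longrightarrow> t' s = t s"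
proof -
  note f = frenet_apparatusD[OF F] and g = frenet_apparatusD[OF G]
  have T: "T' s = T s" if "s \<in> I" for s
    using f(8)[OF that] g(8)[OF that] by (metis vector_derivative_unique_at)
  have kN: "k' s *\<^sub>R N' s = k s *\<^sub>R N s" if "s \<in> I" for s
  proof -
    have "(T has_vector_derivative k' s *\<^sub>R N' s) (at s)"
      by (rule has_vector_derivative_transform_within_open[OF g(9)[OF that] \<open>open I\<close> that])
        (rule T)
    with f(9)[OF that] show ?thesis
      by (metis vector_derivative_unique_at)
  qed
  \<comment> \<open>The sign is taken as an inner product of normals, not as a quotient of
    curvatures: the Frenet equations differentiate the former, while nothing is assumed about
    derivatives of \<open>k\<close> and \<open>k'\<close>.\<close>
  define \<sigma> where "\<sigma> s = N' s \<bullet> N s" for s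
  have kk: "k s = k' s * \<sigma> s" and "k' s = k s * \<sigma> s" if "s \<in> I" for s
    using arg_cong[OF kN[OF that], of "\<lambda>v. v \<bullet> N s"] arg_cong[OF kN[OF that], of "\<lambda>v. v \<bullet> N' s"]
      f(2)[OF that] g(2)[OF that]
    by (auto simp: \<sigma>_def norm_eq_1 inner_commute)
  note k' = this(2)
  have \<sigma>2: "\<sigma> s * \<sigma> s = 1" if "s \<in> I" for s
    using kk[OF that] k'[OF that] k[OF that] by (metis mult.assoc mult_cancel_left1)
  have N: "N' s = \<sigma> s *\<^sub>R N s" if "s \<in> I" for s
  proof -
    have "k s *\<^sub>R N' s = \<sigma> s *\<^sub>R (k' s *\<^sub>R N' s)"
      using kk[OF that] by simp
    also have "\<dots> = k s *\<^sub>R (\<sigma> s *\<^sub>R N s)"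
      by (simp add: kN[OF that])
    finally show ?thesis
      using k[OF that] by (metis scaleR_cancel_left)
  qed
  have B: "B' s = \<sigma> s *\<^sub>R B s" if "s \<in> I" for s
    using f(7)[OF that] g(7)[OF that] T[OF that] N[OF that] by (metis cross_mult_right)
  have "(\<sigma> has_vector_derivative 0) (at s)" if "s \<in> I" for s
  proof -
    \<comment> \<open>Each normal is paired with a combination of the tangent and the binormal, to
      which it is orthogonal.\<close>
    have "N' s \<bullet> (- k s *\<^sub>R T s + t s *\<^sub>R B s) + (- k' s *\<^sub>R T' s + t' s *\<^sub>R B' s) \<bullet> N s = 0"
      using f[OF that] by (simp add: N T B that inner_add inner_diff inner_commute)
    then show ?thesis
      using has_vector_derivative_inner[OF g(10)[OF that] f(10)[OF that]]
      unfolding \<sigma>_def by simp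
  qed
  from constant_on_interval[OF \<open>is_interval I\<close> this]
  obtain e where e: "\<And>s. s \<in> I \<Longrightarrow> \<sigma> s = e"
    by blast
  show ?thesis
  proof (rule that)
    show "k' s = e * k s" if "s \<in> I" for s
      using k'[OF that] e[OF that] by simp
    show "t' s = t s" if "s \<in> I" for s
    proof -
      \<comment> \<open>On \<open>I\<close> the function \<open>e *\<^sub>R N\<close> is
        \<open>N'\<close>. Its derivative is computed in both frames, and the components along
        \<open>B\<close> are compared.\<close>
      have "((\<lambda>s. e *\<^sub>R N s) has_vector_derivative - k' s *\<^sub>R T' s + t' s *\<^sub>R B' s) (at s)"
        by (rule has_vector_derivative_transform_within_open[OF g(10)[OF that] \<open>open I\<close> that])
          (simp add: N e)
      moreover have "((\<lambda>s. e *\<^sub>R N s) has_vector_derivative e *\<^sub>R (- k s *\<^sub>R T s + t s *\<^sub>R B s)) (at s)"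
        using f(10)[OF that]
        by (rule bounded_linear.has_vector_derivative[OF bounded_linear_scaleR_right])
      ultimately have "- k' s *\<^sub>R T' s + t' s *\<^sub>R B' s = e *\<^sub>R (- k s *\<^sub>R T s + t s *\<^sub>R B s)"
        by (rule vector_derivative_unique_at)
      from arg_cong[OF this, of "\<lambda>v. v \<bullet> B s"] have "t' s * e = e * t s"
        using f(3,5)[OF that] by (auto simp add: T B e that inner_add inner_diff norm_eq_1)
      then show ?thesis
        using \<sigma>2[OF that] e[OF that] by auto
    qed
  qed
qed

section \<open>Spherical curves and the rotation system\<close>

text \<open>The pair \<open>(y, x)\<close> is a unit solution of the rotation system with rate
  \<open>t\<close>. Any other solution arises from it by a constant rotation and scaling, with
  constants \<open>a\<close> and \<open>b\<close>; this is applied to the coordinates of the centre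
  relative to the moving frame.\<close>

lemma frenet_sphere_iff:
  assumes "open I" "is_interval I" "I \<noteq> {}"
    and F: "frenet_apparatus I c T N B k t"
    and y: "\<And>s. s \<in> I \<Longrightarrow> (y has_vector_derivative t s * x s) (at s)"
    and x: "\<And>s. s \<in> I \<Longrightarrow> (x has_vector_derivative - t s * y s) (at s)"
    and xy: "\<And>s. s \<in> I \<Longrightarrow> (x s)\<^sup>2 + (y s)\<^sup>2 = 1"
  shows "spherical_curve I c \<longleftrightarrow> (\<exists>a b. \<forall>s\<in>I. k s * (a * y s + b * x s) = 1)"
proof
  note f = frenet_apparatusD[OF F]
  assume "spherical_curve I c"
  then obtain p r where r: "\<And>s. s \<in> I \<Longrightarrow> dist p (c s) = r"
    by (auto simp: spherical_curve_def)
  define v where "v s = c s - p" for s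
  have v: "(v has_vector_derivative T s) (at s)" if "s \<in> I" for s
    unfolding v_def using has_vector_derivative_diff[OF f(8)[OF that] has_vector_derivative_const]
    by simp
  have vT: "v s \<bullet> T s = 0" if "s \<in> I" for s
  proof -
    have "((\<lambda>s. v s \<bullet> v s) has_vector_derivative 0) (at s)"
      by (rule has_vector_derivative_transform_within_open
          [OF has_vector_derivative_const[of "r\<^sup>2"] \<open>open I\<close> that])
        (use r in \<open>simp add: v_def dist_norm norm_minus_commute flip: power2_norm_eq_inner\<close>)
    then show ?thesis
      using vector_derivative_unique_at[OF _ has_vector_derivative_inner[OF v[OF that] v[OF that]]]
      by (fastforce simp: inner_commute)
  qed
  \<comment> \<open>These are the coordinates of the centre seen from the curve:
    \<open>p - c s\<close> is \<open>\<rho> s *\<^sub>R N s + q s *\<^sub>R B s\<close>, since its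
    tangential part vanishes.\<close>
  define \<rho> where "\<rho> s = - (v s \<bullet> N s)" for s
  define q where "q s = - (v s \<bullet> B s)" for s
  have k\<rho>: "k s * \<rho> s = 1" if "s \<in> I" for s
  proof -
    have "((\<lambda>s. v s \<bullet> T s) has_vector_derivative 0) (at s)"
      by (rule has_vector_derivative_transform_within_open
          [OF has_vector_derivative_const[of 0] \<open>open I\<close> that])
        (simp add: vT)
    then have "v s \<bullet> (k s *\<^sub>R N s) + T s \<bullet> T s = 0"
      using has_vector_derivative_inner[OF v[OF that] f(9)[OF that]]
      by (metis vector_derivative_unique_at)
    then show ?thesis
      using f(1)[OF that] by (simp add: \<rho>_def norm_eq_1)
  qed
  have \<rho>': "(\<rho> has_vector_derivative t s * q s) (at s)" if "s \<in> I" for s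
    using has_vector_derivative_minus[OF has_vector_derivative_inner[OF v[OF that] f(10)[OF that]]]
      f[OF that] vT[OF that]
    by (simp add: \<rho>_def[abs_def] q_def inner_add inner_diff)
  have q': "(q has_vector_derivative - t s * \<rho> s) (at s)" if "s \<in> I" for s
    using has_vector_derivative_minus[OF has_vector_derivative_inner[OF v[OF that] f(11)[OF that]]]
      f[OF that]
    by (simp add: \<rho>_def q_def[abs_def])
  \<comment> \<open>The plane vectors \<open>(\<rho>, q)\<close> and \<open>(y, x)\<close> turn at
    the same rate, so their inner product \<open>a\<close> and, below, their planar cross product
    \<open>b\<close> are constant.\<close>
  have "((\<lambda>s. \<rho> s * y s + q s * x s) has_vector_derivative 0) (at s)" if "s \<in> I" for s
    using \<rho>'[OF that] q'[OF that] x[OF that] y[OF that]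
    by (auto intro!: derivative_eq_intros simp: algebra_simps
        simp flip: has_real_derivative_iff_has_vector_derivative)
  from constant_on_interval[OF \<open>is_interval I\<close> this]
  obtain a where a: "\<And>s. s \<in> I \<Longrightarrow> \<rho> s * y s + q s * x s = a"
    by blast
  have "((\<lambda>s. \<rho> s * x s - q s * y s) has_vector_derivative 0) (at s)" if "s \<in> I" for s
    using \<rho>'[OF that] q'[OF that] x[OF that] y[OF that]
    by (auto intro!: derivative_eq_intros simp: algebra_simps
        simp flip: has_real_derivative_iff_has_vector_derivative)
  from constant_on_interval[OF \<open>is_interval I\<close> this]
  obtain b where b: "\<And>s. s \<in> I \<Longrightarrow> \<rho> s * x s - q s * y s = b"
    by blast
  have "k s * (a * y s + b * x s) = 1" if "s \<in> I" for s
  proof -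
    have "a * y s + b * x s = \<rho> s * ((x s)\<^sup>2 + (y s)\<^sup>2)"
      unfolding a[OF that, symmetric] b[OF that, symmetric]
      by (simp add: power2_eq_square algebra_simps)
    then show ?thesis
      using k\<rho>[OF that] xy[OF that] by simp
  qed
  then show "\<exists>a b. \<forall>s\<in>I. k s * (a * y s + b * x s) = 1"
    by blast
next
  note f = frenet_apparatusD[OF F]
  assume "\<exists>a b. \<forall>s\<in>I. k s * (a * y s + b * x s) = 1"
  then obtain a b where ab: "\<And>s. s \<in> I \<Longrightarrow> k s * (a * y s + b * x s) = 1"
    by blast
  define \<rho> where "\<rho> s = a * y s + b * x s" for s
  define q where "q s = a * x s - b * y s" for s
  have \<rho>': "(\<rho> has_vector_derivative t s * q s) (at s)" if "s \<in> I" for s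
    unfolding \<rho>_def q_def using x[OF that] y[OF that]
    by (auto intro!: derivative_eq_intros simp: algebra_simps
        simp flip: has_real_derivative_iff_has_vector_derivative)
  have q': "(q has_vector_derivative - t s * \<rho> s) (at s)" if "s \<in> I" for s
    unfolding \<rho>_def q_def using x[OF that] y[OF that]
    by (auto intro!: derivative_eq_intros simp: algebra_simps
        simp flip: has_real_derivative_iff_has_vector_derivative)
  \<comment> \<open>The candidate centre: the rotation system cancels the components of its
    derivative along \<open>N\<close> and \<open>B\<close>, leaving
    \<open>1 - k s * \<rho> s\<close> along \<open>T\<close>.\<close>
  have "((\<lambda>s. c s + \<rho> s *\<^sub>R N s + q s *\<^sub>R B s) has_vector_derivative 0) (at s)" if "s \<in> I" for s
  proof -
    note D = has_vector_derivative_add[OF has_vector_derivative_add[OF f(8)[OF that]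
        bounded_bilinear.has_vector_derivative[OF bounded_bilinear_scaleR \<rho>'[OF that] f(10)[OF that]]]
        bounded_bilinear.has_vector_derivative[OF bounded_bilinear_scaleR q'[OF that] f(11)[OF that]]]
    have "T s + (\<rho> s *\<^sub>R (- k s *\<^sub>R T s + t s *\<^sub>R B s) + (t s * q s) *\<^sub>R N s)
        + (q s *\<^sub>R (- t s *\<^sub>R N s) + (- t s * \<rho> s) *\<^sub>R B s) = (1 - k s * \<rho> s) *\<^sub>R T s"
      by (simp add: algebra_simps)
    also have "\<dots> = 0"
      using ab[OF that] by (simp add: \<rho>_def)
    finally show ?thesis
      using D by simp
  qed
  from constant_on_interval[OF \<open>is_interval I\<close> this]
  obtain p where p: "\<And>s. s \<in> I \<Longrightarrow> c s + \<rho> s *\<^sub>R N s + q s *\<^sub>R B s = p"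
    by blast
  have "dist p (c s) = sqrt (a\<^sup>2 + b\<^sup>2)" if "s \<in> I" for s
  proof -
    have "p - c s = \<rho> s *\<^sub>R N s + q s *\<^sub>R B s"
      using p[OF that] by (simp add: algebra_simps)
    then have "(dist p (c s))\<^sup>2 = (\<rho> s)\<^sup>2 + (q s)\<^sup>2"
      using f(2,3,6)[OF that]
      by (simp add: dist_norm power2_norm_eq_inner inner_add norm_eq_1 inner_commute)
        (simp add: power2_eq_square)
    also have "\<dots> = (a\<^sup>2 + b\<^sup>2) * ((x s)\<^sup>2 + (y s)\<^sup>2)"
      by (simp add: \<rho>_def q_def power2_eq_square algebra_simps)
    finally show ?thesis
      using xy[OF that] by (simp add: real_sqrt_unique)
  qed
  \<comment> \<open>A sphere needs a positive radius; \<open>a = b = 0\<close> would give 0 = 1 at a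
    point of \<open>I\<close>.\<close>
  moreover have "a \<noteq> 0 \<or> b \<noteq> 0"
    using ab \<open>I \<noteq> {}\<close> by force
  then have "sqrt (a\<^sup>2 + b\<^sup>2) > 0"
    by (simp add: sum_power2_gt_zero_iff)
  ultimately show "spherical_curve I c"
    unfolding spherical_curve_def by (auto intro!: exI[of _ p] exI[of _ "sqrt (a\<^sup>2 + b\<^sup>2)"])
qed

section \<open>Bertrand and B-Bertrand curves as one linear condition\<close>

text \<open>Negating both coefficients exchanges the constants 1 and -1. In the converse,
  \<open>l = 0\<close> forces \<open>m\<close> to be nonzero at any point of \<open>I\<close>, which
  is the B-Bertrand case.\<close>

lemma bertrand_or_B_bertrand_iff:
  assumes "I \<noteq> {}"
  shows "bertrand_curve I c \<or> B_bertrand_curve I c \<longleftrightarrow>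
    (\<exists>k t. has_curvature_torsion I c k t \<and> (\<exists>l m. \<forall>s\<in>I. l * k s + m * t s = 1))"
    (is "_ \<longleftrightarrow> ?R")
proof
  assume "bertrand_curve I c \<or> B_bertrand_curve I c"
  then show ?R
  proof
    assume "bertrand_curve I c"
    then show ?R
      unfolding bertrand_curve_def by blast
  next
    assume "B_bertrand_curve I c"
    then obtain k t l m where "has_curvature_torsion I c k t" "\<forall>s\<in>I. l * k s + m * t s = -1"
      unfolding B_bertrand_curve_def by blast
    then have "\<forall>s\<in>I. (- l) * k s + (- m) * t s = 1"
      by (auto simp: algebra_simps)
    with \<open>has_curvature_torsion I c k t\<close> show ?R
      by blast
  qed
next
  assume ?R
  then obtain k t l m where kt: "has_curvature_torsion I c k t"
    and lm: "\<forall>s\<in>I. l * k s + m * t s = 1"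
    by blast
  show "bertrand_curve I c \<or> B_bertrand_curve I c"
  proof (cases "l = 0")
    case True
    with lm \<open>I \<noteq> {}\<close> have "- m \<noteq> 0"
      by force
    moreover have "\<forall>s\<in>I. 0 * k s + (- m) * t s = - 1"
      using lm True by simp
    ultimately show ?thesis
      using kt unfolding B_bertrand_curve_def by blast
  next
    case False
    then show ?thesis
      using kt lm unfolding bertrand_curve_def by blast
  qed
qed

text \<open>Both definitions quantify over curvature and torsion. By uniqueness any witnesses can be
  exchanged for the given pair, the factor \<open>e\<close> being absorbed into
  \<open>l\<close>.\<close>

lemma has_curvature_torsion_bertrand_iff:
  assumes "open I" "is_interval I" "I \<noteq> {}"
    and ct: "has_curvature_torsion I c k t" and k: "\<And>s. s \<in> I \<Longrightarrow> k s \<noteq> 0"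
  shows "bertrand_curve I c \<or> B_bertrand_curve I c \<longleftrightarrow> (\<exists>l m. \<forall>s\<in>I. l * k s + m * t s = 1)"
proof -
  have "\<exists>l m. \<forall>s\<in>I. l * k s + m * t s = 1"
    if ct': "has_curvature_torsion I c k' t'" and lm: "\<forall>s\<in>I. l * k' s + m * t' s = 1"
    for k' t' l m
  proof -
    from ct ct' obtain T N B T' N' B' where
      F: "frenet_apparatus I c T N B k t" "frenet_apparatus I c T' N' B' k' t'"
      unfolding has_curvature_torsion_def by blast
    obtain e where e: "\<And>s. s \<in> I \<Longrightarrow> k' s = e * k s" "\<And>s. s \<in> I \<Longrightarrow> t' s = t s"
      using frenet_curvature_torsion_unique[OF assms(1,2) F k] by metis
    have "\<forall>s\<in>I. (l * e) * k s + m * t s = 1"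
      using lm e by (simp add: mult.assoc)
    then show ?thesis
      by blast
  qed
  then show ?thesis
    unfolding bertrand_or_B_bertrand_iff[OF \<open>I \<noteq> {}\<close>] using ct by blast
qed

section \<open>The Frenet frame of the curve whose normal is the tangent of the first\<close>

text \<open>Differentiating \<open>U s \<bullet> U s = 1\<close> gives
  \<open>U s \<bullet> T s = 0\<close>, as \<open>S\<close> has no zeros; differentiating that gives
  the formula for \<open>S\<close>. The third frame vector is \<open>U \<times> T\<close>, written
  in the frame of \<open>c\<close> so that the Frenet equations differentiate it.\<close>

lemma tangent_normal_frenet:
  assumes "open I"
    and F: "frenet_apparatus I c T N B k t"
    and norm_U: "\<And>s. s \<in> I \<Longrightarrow> norm (U s) = 1"
    and d: "\<And>s. s \<in> I \<Longrightarrow> (d has_vector_derivative U s) (at s)"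
    and U: "\<And>s. s \<in> I \<Longrightarrow> (U has_vector_derivative S s *\<^sub>R T s) (at s)"
    and S: "\<And>s. s \<in> I \<Longrightarrow> S s \<noteq> 0"
  shows "frenet_apparatus I d U T (\<lambda>s. (U s \<bullet> B s) *\<^sub>R N s - (U s \<bullet> N s) *\<^sub>R B s) S
      (\<lambda>s. k s * (U s \<bullet> B s))"
    and "\<And>s. s \<in> I \<Longrightarrow> S s = - k s * (U s \<bullet> N s)"
    and "\<And>s. s \<in> I \<Longrightarrow> ((\<lambda>s. U s \<bullet> N s) has_vector_derivative t s * (U s \<bullet> B s)) (at s)"
    and "\<And>s. s \<in> I \<Longrightarrow> ((\<lambda>s. U s \<bullet> B s) has_vector_derivative - t s * (U s \<bullet> N s)) (at s)"
    and "\<And>s. s \<in> I \<Longrightarrow> (U s \<bullet> B s)\<^sup>2 + (U s \<bullet> N s)\<^sup>2 = 1"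
proof -
  note f = frenet_apparatusD[OF F]
  have UT: "U s \<bullet> T s = 0" if "s \<in> I" for s
  proof -
    have "((\<lambda>s. U s \<bullet> U s) has_vector_derivative 0) (at s)"
      by (rule has_vector_derivative_transform_within_open
          [OF has_vector_derivative_const[of 1] \<open>open I\<close> that])
        (use norm_U in \<open>simp add: norm_eq_1\<close>)
    then have "U s \<bullet> (S s *\<^sub>R T s) + (S s *\<^sub>R T s) \<bullet> U s = 0"
      using has_vector_derivative_inner[OF U[OF that] U[OF that]]
      by (metis vector_derivative_unique_at)
    then show ?thesis
      using S[OF that] by (simp add: inner_commute)
  qed
  show Seq: "S s = - k s * (U s \<bullet> N s)" if "s \<in> I" for s
  proof -
    have "((\<lambda>s. U s \<bullet> T s) has_vector_derivative 0) (at s)"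
      by (rule has_vector_derivative_transform_within_open
          [OF has_vector_derivative_const[of 0] \<open>open I\<close> that])
        (simp add: UT)
    then have "U s \<bullet> (k s *\<^sub>R N s) + (S s *\<^sub>R T s) \<bullet> T s = 0"
      using has_vector_derivative_inner[OF U[OF that] f(9)[OF that]]
      by (metis vector_derivative_unique_at)
    then show ?thesis
      using f(1)[OF that] by (simp add: norm_eq_1)
  qed
  show y: "((\<lambda>s. U s \<bullet> N s) has_vector_derivative t s * (U s \<bullet> B s)) (at s)" if "s \<in> I" for s
    using has_vector_derivative_inner[OF U[OF that] f(10)[OF that]] UT[OF that] f[OF that]
    by (simp add: inner_add inner_diff)
  show x: "((\<lambda>s. U s \<bullet> B s) has_vector_derivative - t s * (U s \<bullet> N s)) (at s)" if "s \<in> I" for s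
    using has_vector_derivative_inner[OF U[OF that] f(11)[OF that]] f[OF that]
    by simp
  show xy: "(U s \<bullet> B s)\<^sup>2 + (U s \<bullet> N s)\<^sup>2 = 1" if "s \<in> I" for s
    using frenet_inner[OF F that, of "U s" "U s"] UT[OF that] norm_U[OF that]
    by (simp add: norm_eq_1 power2_eq_square)
  have Ueq: "U s = (U s \<bullet> N s) *\<^sub>R N s + (U s \<bullet> B s) *\<^sub>R B s" if "s \<in> I" for s
    using frenet_expansion[OF F that, of "U s"] UT[OF that] by simp
  show "frenet_apparatus I d U T (\<lambda>s. (U s \<bullet> B s) *\<^sub>R N s - (U s \<bullet> N s) *\<^sub>R B s) S
      (\<lambda>s. k s * (U s \<bullet> B s))"
    unfolding frenet_apparatus_def
  proof (intro ballI)
    fix s assume s: "s \<in> I"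
    note f = f[OF s]
    define x where "x = U s \<bullet> B s"
    define y where "y = U s \<bullet> N s"
    define V where "V = x *\<^sub>R N s - y *\<^sub>R B s"
    have xy: "x * x + y * y = 1"
      using xy[OF s] by (simp add: x_def y_def power2_eq_square)
    have Ueq: "U s = y *\<^sub>R N s + x *\<^sub>R B s"
      using Ueq[OF s] by (simp add: x_def y_def)
    have fr: "N s \<bullet> N s = 1" "B s \<bullet> B s = 1" "B s \<bullet> N s = 0" "N s \<bullet> T s = 0" "B s \<bullet> T s = 0"
      using f by (simp_all add: norm_eq_1 inner_commute)
    have V: "norm V = 1" "T s \<bullet> V = 0" "U s \<bullet> V = 0"
      using xy fr f by (simp_all add: V_def Ueq norm_eq_1 inner_diff inner_add algebra_simps)
    \<comment> \<open>The determinant is a triple product; once \<open>T s \<times> V = U s\<close>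
      is known, it equals the squared norm of \<open>U s\<close>.\<close>
    have "det (vector [U s, T s, V] :: real^3^3) = U s \<bullet> (T s \<times> V)"
      by (simp add: dot_cross_det)
    also have "T s \<times> V = U s"
    proof -
      have "T s \<times> B s = - N s"
        using Lagrange[of "T s" "T s" "N s"] f by (simp add: norm_eq_1)
      then show ?thesis
        using f(7) by (simp add: V_def Ueq Cross3.right_diff_distrib cross_mult_right)
    qed
    finally have det: "det (vector [U s, T s, V] :: real^3^3) > 0"
      using norm_U[OF s] by (simp add: norm_eq_1)
    have T': "k s *\<^sub>R N s = - S s *\<^sub>R U s + (k s * x) *\<^sub>R V"
    proof -
      have "- S s *\<^sub>R U s + (k s * x) *\<^sub>R V = (k s * (x * x + y * y)) *\<^sub>R N s"
        unfolding Seq[OF s] y_def[symmetric] V_def by (simp add: Ueq algebra_simps)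
      then show ?thesis
        by (simp add: xy)
    qed
    \<comment> \<open>In the product rule all terms with \<open>t s\<close> cancel, so only the
      tangential term survives.\<close>
    have "((\<lambda>s. (U s \<bullet> B s) *\<^sub>R N s - (U s \<bullet> N s) *\<^sub>R B s) has_vector_derivative
        (x *\<^sub>R (- k s *\<^sub>R T s + t s *\<^sub>R B s) + (- t s * y) *\<^sub>R N s)
        - (y *\<^sub>R (- t s *\<^sub>R N s) + (t s * x) *\<^sub>R B s)) (at s)"
      unfolding x_def y_def
      by (intro has_vector_derivative_diff
          bounded_bilinear.has_vector_derivative[OF bounded_bilinear_scaleR] y x f s)
    then have "((\<lambda>s. (U s \<bullet> B s) *\<^sub>R N s - (U s \<bullet> N s) *\<^sub>R B s) has_vector_derivative
        - (k s * x) *\<^sub>R T s) (at s)"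
      by (simp add: algebra_simps)
    then show "norm (U s) = 1 \<and> norm (T s) = 1 \<and>
        norm ((U s \<bullet> B s) *\<^sub>R N s - (U s \<bullet> N s) *\<^sub>R B s) = 1 \<and>
        U s \<bullet> T s = 0 \<and> U s \<bullet> ((U s \<bullet> B s) *\<^sub>R N s - (U s \<bullet> N s) *\<^sub>R B s) = 0 \<and>
        T s \<bullet> ((U s \<bullet> B s) *\<^sub>R N s - (U s \<bullet> N s) *\<^sub>R B s) = 0 \<and>
        det (vector [U s, T s, (U s \<bullet> B s) *\<^sub>R N s - (U s \<bullet> N s) *\<^sub>R B s] :: real^3^3) > 0 \<and>
        (d has_vector_derivative U s) (at s) \<and>
        (U has_vector_derivative S s *\<^sub>R T s) (at s) \<and>
        (T has_vector_derivative - S s *\<^sub>R U s +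
          (k s * (U s \<bullet> B s)) *\<^sub>R ((U s \<bullet> B s) *\<^sub>R N s - (U s \<bullet> N s) *\<^sub>R B s)) (at s) \<and>
        ((\<lambda>s. (U s \<bullet> B s) *\<^sub>R N s - (U s \<bullet> N s) *\<^sub>R B s) has_vector_derivative
          - (k s * (U s \<bullet> B s)) *\<^sub>R T s) (at s)"
      using norm_U[OF s] f(1,9) V UT[OF s] det d[OF s] U[OF s] T'
      unfolding V_def x_def y_def by simp
  qed
qed

section \<open>Comparing sphericity with the linear condition\<close>

theorem theorem4p2:
  fixes I :: "real set"
    and \<gamma> \<beta> :: "real \<Rightarrow> real ^ 3"
    and \<kappa> \<tau> S_T :: "real \<Rightarrow> real"
    and \<theta>\<^sub>0 :: real
  assumes "open I" and "is_interval I" and "0 \<in> I"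
    and "unit_speed_curve I \<gamma>"
    and "unit_speed_curve I \<beta>"
    and "has_curvature_torsion I \<gamma> \<kappa> \<tau>"
    and "\<And>s. s \<in> I \<Longrightarrow> \<kappa> s > 0"
    and "\<And>s. s \<in> I \<Longrightarrow> S_T s = \<kappa> s * cos ((LBINT u=ereal 0..ereal s. \<tau> u) + \<theta>\<^sub>0)"
    and "\<And>s. s \<in> I \<Longrightarrow> S_T s \<noteq> 0"
    and "\<And>s. s \<in> I \<Longrightarrow> nth_vderiv 2 \<beta> s = S_T s *\<^sub>R nth_vderiv 1 \<gamma> s"
  shows "spherical_curve I \<gamma> \<longleftrightarrow> bertrand_curve I \<beta> \<or> B_bertrand_curve I \<beta>"
proof -
  have "I \<noteq> {}"
    using \<open>0 \<in> I\<close> by blast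
  obtain T N B where F: "frenet_apparatus I \<gamma> T N B \<kappa> \<tau>"
    using assms(6) by (auto simp: has_curvature_torsion_def)
  define U where "U = nth_vderiv 1 \<beta>"
  have smooth: "nth_vderiv n \<beta> differentiable (at s)" if "s \<in> I" for s n
    using assms(5) that by (auto simp: unit_speed_curve_def smooth_curve_def)
  have norm_U: "norm (U s) = 1" if "s \<in> I" for s
    using assms(5) that by (auto simp: unit_speed_curve_def U_def)
  have \<beta>': "(\<beta> has_vector_derivative U s) (at s)" if "s \<in> I" for s
    using smooth[OF that, of 0] by (simp add: U_def nth_vderiv_def vector_derivative_works)
  have U': "(U has_vector_derivative S_T s *\<^sub>R T s) (at s)" if "s \<in> I" for s
  proof -
    have "nth_vderiv 1 \<gamma> s = T s"
      using frenet_apparatusD(8)[OF F that] by (simp add: nth_vderiv_def vector_derivative_at)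
    moreover have "vector_derivative U (at s) = nth_vderiv 2 \<beta> s"
      by (simp add: U_def nth_vderiv_def numeral_2_eq_2)
    ultimately have "vector_derivative U (at s) = S_T s *\<^sub>R T s"
      using assms(10)[OF that] by simp
    then show ?thesis
      using smooth[OF that, of 1] by (metis U_def vector_derivative_works)
  qed
  note K = tangent_normal_frenet[OF \<open>open I\<close> F norm_U \<beta>' U' assms(9)]
  have "spherical_curve I \<gamma> \<longleftrightarrow>
      (\<exists>a b. \<forall>s\<in>I. \<kappa> s * (a * (U s \<bullet> N s) + b * (U s \<bullet> B s)) = 1)"
    by (rule frenet_sphere_iff[OF assms(1,2) \<open>I \<noteq> {}\<close> F K(3-5)])
  also have "\<dots> \<longleftrightarrow> (\<exists>l m. \<forall>s\<in>I. l * S_T s + m * (\<kappa> s * (U s \<bullet> B s)) = 1)"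
  proof -
    \<comment> \<open>Since \<open>S_T s = - \<kappa> s * (U s \<bullet> N s)\<close>, the
      coefficients correspond by \<open>l = - a\<close> and \<open>m = b\<close>.\<close>
    have "\<kappa> s * (a * (U s \<bullet> N s) + b * (U s \<bullet> B s)) = (- a) * S_T s + b * (\<kappa> s * (U s \<bullet> B s))"
      if "s \<in> I" for s a b
      by (simp add: K(2) that algebra_simps)
    then show ?thesis
      by (metis minus_minus)
  qed
  also have "\<dots> \<longleftrightarrow> bertrand_curve I \<beta> \<or> B_bertrand_curve I \<beta>"
  proof -
    have "has_curvature_torsion I \<beta> S_T (\<lambda>s. \<kappa> s * (U s \<bullet> B s))"
      using K(1) by (auto simp: has_curvature_torsion_def)
    then show ?thesis
      using has_curvature_torsion_bertrand_iff[OF assms(1,2) \<open>I \<noteq> {}\<close>] assms(9) by simp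
  qed
  finally show ?thesis .
qed

unbundle no cross3_syntax

end
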